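(* Fix a positive integer $N$ and let $g:\mathbb{N}\to\mathbb{R}$ be an $N$-density like arithmetic function such that the series $\sum_{d=1}^{\infty}\frac{1-g(d)}{d}$ converges. Set $f(n)=\prod_{d\mid n}g(d)$. Let $\{L_t\}_{t\ge 1}$ be a sequence of positive integers such that: (i) $L_t$ divides $L_{t+1}$ for all $t\ge 1$; (ii) $\lim_{t\to+\infty}L_t=+\infty$; (iii) there exists a function $h:\mathbb{R}_{>0}\to\mathbb{R}$ with $\lim_{x\to+\infty}h(x)=+\infty$ such that $h(t)<n$ for every integer $n\ge 1$ with $\gcd(n,N)=1$ that does not divide $L_t$. Then the sequence $A_t=\frac{1}{L_t}\sum_{r\mid L_t}f(r)\varphi\!\left(\frac{L_t}{r}\right)$ converges to a limit $A_f\in[0,1]$, and $$A_f=\lim_{x\to+\infty}\frac{1}{x}\sum_{n\le x}f(n).$$ Moreover, if there exists $c>0$ such that $g(d)>c$ for all $d\ge 1$, then the series $$A_f^*:=\sum_{d=1}^{\infty}\frac{\log g(d)}{d}=\sum_{d\ge 1,\ \gcd(d,N)=1}\frac{\log g(d)}{d}$$ converges, $A_f^*=\lim_{x\to+\infty}\frac{1}{x}\sum_{n\le x}\log f(n)$, and $$A_f\ge \exp(A_f^* )=\prod_{d=1}^{\infty}g(d)^{1/d}>0,$$ so that $f$ has a nonzero mean value.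
   Context: $\varphi$ denotes Euler's totient function. For a fixed positive integer $N$, an arithmetic function $g$ is called $N$-density like if $0<g(n)\le 1$ for every positive integer $n$, with $g(n)=1$ whenever $\gcd(n,N)>1$. *)

theory Defs
  imports "HOL-Analysis.Analysis" "HOL-Number_Theory.Totient"
begin

text \<open>Arithmetic functions are functions on \<open>nat\<close>; the value at \<open>0\<close> is junk and is never used.
  In particular series over \<open>d \<ge> 1\<close> are written with the index shifted by \<open>Suc\<close>.\<close>

definition density_like :: "nat \<Rightarrow> (nat \<Rightarrow> real) \<Rightarrow> bool" where
  "density_like N g \<longleftrightarrow>
     (\<forall>n\<ge>1. 0 < g n \<and> g n \<le> 1) \<and> (\<forall>n\<ge>1. gcd n N > 1 \<longrightarrow> g n = 1)"

definition divisor_prod :: "(nat \<Rightarrow> real) \<Rightarrow> nat \<Rightarrow> real" where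
  "divisor_prod g n = (\<Prod>d | d dvd n. g d)"

definition has_mean_value :: "(nat \<Rightarrow> real) \<Rightarrow> real \<Rightarrow> bool" where
  "has_mean_value f m \<longleftrightarrow>
     ((\<lambda>x::real. 1 / x * (\<Sum>n | 1 \<le> n \<and> real n \<le> x. f n)) \<longlongrightarrow> m) at_top"

end

theory Submission
  imports Defs
begin

text \<open>
  Put \<open>f\<^sub>t n = f (gcd n L\<^sub>t)\<close>, which only sees the divisors of \<open>n\<close> that divide \<open>L\<^sub>t\<close>. It is periodic
  modulo \<open>L\<^sub>t\<close>, and grouping a period by the value of the gcd shows that its mean value is \<open>A\<^sub>t\<close>.
  Since \<open>0 \<le> f\<^sub>t n - f n \<le> \<Sum>(1 - g d)\<close> over the divisors \<open>d\<close> of \<open>n\<close> not dividing \<open>L\<^sub>t\<close>, the averages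
  of \<open>f\<^sub>t\<close> and \<open>f\<close> differ by at most \<open>\<Sum>(1 - g d) / d\<close> over all \<open>d\<close> not dividing \<open>L\<^sub>t\<close>, which tends
  to \<open>0\<close> because every \<open>d\<close> with \<open>g d \<noteq> 1\<close> eventually divides \<open>L\<^sub>t\<close>. The convergence is thus uniform
  in the length of the average and the limits can be exchanged. For the logarithm,
  \<open>- ln g \<le> (1 - g) / g\<close> gives absolute convergence, and the bound on the mean value is the
  inequality between arithmetic and geometric means.
\<close>

section \<open>Averages over initial segments, and mean values over a real variable\<close>

definition average :: "(nat \<Rightarrow> real) \<Rightarrow> nat \<Rightarrow> real" where
  "average f n = (\<Sum>k=1..n. f k) / real n"

lemma average_mono:
  assumes "\<And>k. 1 \<le> k \<Longrightarrow> k \<le> n \<Longrightarrow> f k \<le> g k"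
  shows "average f n \<le> average g n"
  unfolding average_def by (intro divide_right_mono sum_mono) (use assms in auto)

lemma average_diff: "average (\<lambda>k. f k - g k) n = average f n - average g n"
  by (simp add: average_def sum_subtractf diff_divide_distrib)

text \<open>For \<open>x\<close> at least \<open>1\<close> the mean up to \<open>x\<close> is the
  average up to the floor of \<open>x\<close>, times the factor
  \<open>real (nat \<lfloor>x\<rfloor>) / x\<close>. This factor tends to \<open>1\<close>, so a
  limit along the integers suffices.\<close>

lemma has_mean_valueI:
  assumes "average f \<longlonglongrightarrow> m"
  shows "has_mean_value f m"
proof -
  have floor_lim: "filterlim (\<lambda>x::real. nat \<lfloor>x\<rfloor>) at_top at_top"
    by (intro filterlim_compose[OF filterlim_nat_sequentially filterlim_floor_sequentially])
  have lim: "((\<lambda>x::real. average f (nat \<lfloor>x\<rfloor>)) \<longlongrightarrow> m) at_top"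
    by (rule filterlim_compose[OF assms floor_lim])
  have quot: "((\<lambda>x::real. real (nat \<lfloor>x\<rfloor>) / x) \<longlongrightarrow> 1) at_top"
  proof (rule tendsto_sandwich)
    show "eventually (\<lambda>x::real. 1 - 1 / x \<le> real (nat \<lfloor>x\<rfloor>) / x) at_top"
      using eventually_gt_at_top[of 0]
    proof eventually_elim
      case (elim x)
      have "x - 1 \<le> real (nat \<lfloor>x\<rfloor>)" using elim by linarith
      then have "(x - 1) / x \<le> real (nat \<lfloor>x\<rfloor>) / x" using elim by (intro divide_right_mono) auto
      then show ?case using elim by (simp add: diff_divide_distrib)
    qed
    show "eventually (\<lambda>x::real. real (nat \<lfloor>x\<rfloor>) / x \<le> 1) at_top"
      using eventually_gt_at_top[of 0] by eventually_elim simp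
    have "((\<lambda>x::real. 1 - 1 / x) \<longlongrightarrow> 1 - 0) at_top"
      by (intro tendsto_intros tendsto_divide_0[OF tendsto_const]
          filterlim_at_top_imp_at_infinity filterlim_ident)
    then show "((\<lambda>x::real. 1 - 1 / x) \<longlongrightarrow> 1) at_top" by simp
  qed auto
  have "((\<lambda>x::real. real (nat \<lfloor>x\<rfloor>) / x * average f (nat \<lfloor>x\<rfloor>)) \<longlongrightarrow> 1 * m) at_top"
    by (intro tendsto_mult quot lim)
  moreover have "eventually (\<lambda>x::real. real (nat \<lfloor>x\<rfloor>) / x * average f (nat \<lfloor>x\<rfloor>) =
      1 / x * (\<Sum>n | 1 \<le> n \<and> real n \<le> x. f n)) at_top"
    using eventually_ge_at_top[of 1]
  proof eventually_elim
    case (elim x)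
    have "{n. 1 \<le> n \<and> real n \<le> x} = {1..nat \<lfloor>x\<rfloor>}" using elim by (auto simp: le_nat_floor) linarith
    moreover have "nat \<lfloor>x\<rfloor> \<noteq> 0" using elim by linarith
    ultimately show ?case by (simp add: average_def)
  qed
  ultimately show ?thesis
    unfolding has_mean_value_def mult_1 by (rule Lim_transform_eventually)
qed

section \<open>Periodic functions and sums over gcds\<close>

lemma average_periodic:
  fixes F :: "nat \<Rightarrow> real"
  assumes "p > 0" and per: "\<And>k. F (k + p) = F k"
  shows "average F \<longlonglongrightarrow> average F p"
proof -
  define c where "c = average F p"
  \<comment> \<open>Once the mean \<open>c\<close> over one period is subtracted, the partial sums
    are themselves periodic, hence bounded, and the average differs from \<open>c\<close> by
    O(1/n).\<close>
  define T where "T n = (\<Sum>k<n. F (Suc k) - c)" for n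
  have "(\<Sum>k<p. F (Suc k)) = p * c"
    using \<open>p > 0\<close> by (simp add: c_def average_def sum.atLeast1_atMost_eq)
  then have Tp: "T p = 0" by (simp add: T_def sum_subtractf)
  have shift: "T (n + p) = T n" for n
  proof (induction n)
    case (Suc n)
    have "F (Suc (n + p)) = F (Suc n)" using per[of "Suc n"] by simp
    then show ?case using Suc by (simp add: T_def)
  qed (use Tp in \<open>simp add: T_def\<close>)
  have "T (m + q * p) = T m" for m q
    by (induction q) (simp_all add: shift add.assoc[symmetric] add.commute[of p])
  then have T_mod: "T n = T (n mod p)" for n
    by (metis mod_mult_div_eq mult.commute)
  \<comment> \<open>The sum over all residues is a convenient stand-in for the maximum of the
    finitely many values of \<open>\<bar>T m\<bar>\<close>.\<close>
  have bound: "\<bar>T n\<bar> \<le> (\<Sum>m<p. \<bar>T m\<bar>)" for n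
    unfolding T_mod[of n] using \<open>p > 0\<close> by (intro member_le_sum) auto
  have "(\<lambda>n. average F n - c) \<longlonglongrightarrow> 0"
  proof (rule Lim_null_comparison)
    show "eventually (\<lambda>n. norm (average F n - c) \<le> (\<Sum>m<p. \<bar>T m\<bar>) / real n) sequentially"
      using eventually_gt_at_top[of 0]
    proof eventually_elim
      case (elim n)
      have "average F n - c = T n / n"
        using elim by (simp add: average_def T_def sum_subtractf sum.atLeast1_atMost_eq field_simps)
      then show ?case using bound[of n] elim by (simp add: divide_right_mono)
    qed
    show "(\<lambda>n. (\<Sum>m<p. \<bar>T m\<bar>) / real n) \<longlonglongrightarrow> 0" by (rule lim_const_over_n)
  qed
  then show ?thesis unfolding c_def by (rule LIM_zero_cancel)
qed

text \<open>The fibre of \<open>gcd k n\<close> over a divisor \<open>r\<close> consists of the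
  \<open>k = r * j\<close> with \<open>j\<close> coprime to \<open>n div r\<close>, so it has
  \<open>totient (n div r)\<close> elements.\<close>

lemma sum_gcd_eq_totient_sum:
  fixes f :: "nat \<Rightarrow> real"
  assumes "n > 0"
  shows "(\<Sum>k=1..n. f (gcd k n)) = (\<Sum>r | r dvd n. f r * real (totient (n div r)))"
proof -
  have "(\<Sum>k=1..n. f (gcd k n)) = (\<Sum>r | r dvd n. \<Sum>k | k \<in> {1..n} \<and> gcd k n = r. f (gcd k n))"
    using assms by (intro sum.group[symmetric]) auto
  also have "\<dots> = (\<Sum>r | r dvd n. f r * real (totient (n div r)))"
  proof (rule sum.cong[OF refl])
    fix r assume "r \<in> {r. r dvd n}"
    moreover have "{k. k \<in> {1..n} \<and> gcd k n = r} = {k\<in>{0<..n}. gcd k n = r}" by auto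
    ultimately show "(\<Sum>k | k \<in> {1..n} \<and> gcd k n = r. f (gcd k n)) = f r * real (totient (n div r))"
      using card_gcd_eq_totient[of n r] assms by simp
  qed
  finally show ?thesis .
qed

section \<open>Averages of divisor sums\<close>

lemma card_multiples:
  assumes "d > 0"
  shows "card {k\<in>{1..n}. d dvd k} = n div (d::nat)"
proof -
  have "{k\<in>{1..n}. d dvd k} = (*) d ` {1..n div d}"
  proof (intro equalityI subsetI)
    fix k assume "k \<in> {k\<in>{1..n}. d dvd k}"
    then obtain m where m: "k = d * m" "1 \<le> k" "k \<le> n" by auto
    then have "1 \<le> m" "m \<le> n div d" using assms by (auto simp: less_eq_div_iff_mult_less_eq mult.commute Suc_le_eq)
    then show "k \<in> (*) d ` {1..n div d}" using m by auto
  next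
    fix k assume "k \<in> (*) d ` {1..n div d}"
    then show "k \<in> {k\<in>{1..n}. d dvd k}"
      using assms by (auto simp: less_eq_div_iff_mult_less_eq mult.commute Suc_le_eq)
  qed
  then show ?thesis using assms by (simp add: card_image inj_on_def)
qed

text \<open>Swapping the two summations counts each \<open>w d\<close> once for every multiple of
  \<open>d\<close> up to \<open>n\<close>.\<close>

lemma average_divisor_sum:
  "average (\<lambda>k. \<Sum>d | d dvd k. w d) n = (\<Sum>d<n. w (Suc d) * (real (n div Suc d) / real n))"
proof -
  have "(\<Sum>k=1..n. \<Sum>d | d dvd k. w d) = (\<Sum>k=1..n. \<Sum>d | d \<in> {1..n} \<and> d dvd k. w d)"
  proof (intro sum.cong refl)
    fix k assume "k \<in> {1..n}"
    then show "{d. d dvd k} = {d. d \<in> {1..n} \<and> d dvd k}"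
      by (auto intro: dvd_pos_nat Suc_leI dest: dvd_imp_le)
  qed
  also have "\<dots> = (\<Sum>d=1..n. \<Sum>k | k \<in> {1..n} \<and> d dvd k. w d)"
    by (rule sum.swap_restrict) auto
  also have "\<dots> = (\<Sum>d=1..n. w d * real (n div d))"
    by (intro sum.cong refl) (use card_multiples in auto)
  finally show ?thesis
    by (simp add: average_def sum.atLeast1_atMost_eq sum_divide_distrib)
qed

lemma div_div_le_inverse: "real (n div Suc d) / real n \<le> 1 / real (Suc d)"
proof (cases "n = 0")
  case False
  have "real (n div Suc d) \<le> real n / real (Suc d)" by (rule of_nat_div_le_of_nat)
  then have "real (n div Suc d) / real n \<le> real n / real (Suc d) / real n"
    by (rule divide_right_mono) simp
  then show ?thesis using False by simp
qed simp

text \<open>The point is that the bound is independent of \<open>n\<close>; it later makes the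
  truncation error uniform.\<close>

lemma average_divisor_sum_le:
  assumes "\<And>d. 0 \<le> w (Suc d)" and "summable (\<lambda>d. w (Suc d) / real (Suc d))"
  shows "average (\<lambda>k. \<Sum>d | d dvd k. w d) n \<le> (\<Sum>d. w (Suc d) / real (Suc d))"
proof -
  have "average (\<lambda>k. \<Sum>d | d dvd k. w d) n \<le> (\<Sum>d<n. w (Suc d) / real (Suc d))"
    unfolding average_divisor_sum
  proof (rule sum_mono)
    fix d
    show "w (Suc d) * (real (n div Suc d) / real n) \<le> w (Suc d) / real (Suc d)"
      using mult_left_mono[OF div_div_le_inverse[of n d] assms(1)[of d]] by simp
  qed
  also have "\<dots> \<le> (\<Sum>d. w (Suc d) / real (Suc d))"
    by (rule sum_le_suminf) (use assms in auto)
  finally show ?thesis .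
qed

text \<open>Dominated convergence for series. It serves twice: for averages as their length grows,
  and for the truncation error as \<open>t\<close> grows.\<close>

lemma tannery_sequentially:
  fixes a :: "nat \<Rightarrow> nat \<Rightarrow> real"
  assumes "\<And>k. (\<lambda>n. a k n) \<longlonglongrightarrow> b k" and "\<And>k n. \<bar>a k n\<bar> \<le> M k" and "summable M"
  shows "(\<lambda>n. \<Sum>k. a k n) \<longlonglongrightarrow> (\<Sum>k. b k)"
proof -
  have "eventually (\<lambda>(k, n). norm (a k n) \<le> M k) (at_top \<times>\<^sub>F sequentially)"
    by (rule always_eventually) (use assms(2) in auto)
  from tannerys_theorem[OF assms(1) this assms(3)] show ?thesis by simp
qed

text \<open>The proportion of multiples of \<open>d\<close> among the first \<open>n\<close>
  integers tends to \<open>1/d\<close> and never exceeds it, so the terms converge one by one under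
  a summable bound.\<close>

lemma average_divisor_sum_tendsto:
  assumes "summable (\<lambda>d. \<bar>w (Suc d)\<bar> / real (Suc d))"
  shows "average (\<lambda>k. \<Sum>d | d dvd k. w d) \<longlonglongrightarrow> (\<Sum>d. w (Suc d) / real (Suc d))"
proof -
  have "(\<lambda>n. \<Sum>d. w (Suc d) * (real (n div Suc d) / real n)) \<longlonglongrightarrow> (\<Sum>d. w (Suc d) / real (Suc d))"
  proof (rule tannery_sequentially)
    show "(\<lambda>n. w (Suc d) * (real (n div Suc d) / real n)) \<longlonglongrightarrow> w (Suc d) / real (Suc d)" for d
    proof -
      have "(\<lambda>n. real (n div Suc d) / real n) \<longlonglongrightarrow> 1 / real (Suc d)"
      proof (rule tendsto_sandwich)
        show "eventually (\<lambda>n. 1 / real (Suc d) - 1 / real n \<le> real (n div Suc d) / real n) sequentially"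
          using eventually_gt_at_top[of 0]
        proof eventually_elim
          case (elim n)
          have "real n / real (Suc d) - 1 \<le> real (n div Suc d)"
            using floor_divide_of_nat_eq[of n "Suc d", where ?'a = real] by linarith
          then have "(real n / real (Suc d) - 1) / real n \<le> real (n div Suc d) / real n"
            by (rule divide_right_mono) simp
          then show ?case using elim by (simp add: diff_divide_distrib)
        qed
        show "eventually (\<lambda>n. real (n div Suc d) / real n \<le> 1 / real (Suc d)) sequentially"
          using div_div_le_inverse by (intro always_eventually) blast
        show "(\<lambda>n. 1 / real (Suc d) - 1 / real n) \<longlonglongrightarrow> 1 / real (Suc d)"
          using tendsto_diff[OF tendsto_const lim_const_over_n[of 1]] by simp
      qed simp
      from tendsto_mult[OF tendsto_const this, of "w (Suc d)"] show ?thesis by simp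
    qed
    show "\<bar>w (Suc d) * (real (n div Suc d) / real n)\<bar> \<le> \<bar>w (Suc d)\<bar> / real (Suc d)" for d n
      using mult_left_mono[OF div_div_le_inverse, of "\<bar>w (Suc d)\<bar>" n d] by (simp add: abs_mult)
  qed (rule assms)
  \<comment> \<open>The series is really a finite sum: for \<open>d \<ge> n\<close> the quotient
    \<open>n div Suc d\<close> is \<open>0\<close>.\<close>
  moreover have "(\<Sum>d. w (Suc d) * (real (n div Suc d) / real n)) =
      average (\<lambda>k. \<Sum>d | d dvd k. w d) n" for n
    unfolding average_divisor_sum by (rule suminf_finite) auto
  ultimately show ?thesis by simp
qed

section \<open>Inequalities for products, exponentials and logarithms\<close>

lemma one_minus_prod_le_sum:
  fixes g :: "'a \<Rightarrow> real"
  assumes "finite S" and "\<And>x. x \<in> S \<Longrightarrow> 0 \<le> g x \<and> g x \<le> 1"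
  shows "1 - (\<Prod>x\<in>S. g x) \<le> (\<Sum>x\<in>S. 1 - g x)"
  using assms
proof (induction S rule: finite_induct)
  case (insert x S)
  then have "0 \<le> (\<Prod>x\<in>S. g x)" "(\<Prod>x\<in>S. g x) \<le> 1" by (auto intro!: prod_nonneg prod_le_1)
  \<comment> \<open>With P the product over \<open>S\<close>, the identity 1 - g P = (1 - g) + (1 -
    P) - (1 - g)(1 - P) shows that this nonnegative term is what the induction step
    discards.\<close>
  then have "0 \<le> (1 - g x) * (1 - (\<Prod>x\<in>S. g x))" using insert.prems by (intro mult_nonneg_nonneg) auto
  then show ?case using insert by (simp add: algebra_simps)
qed simp

text \<open>Jensen's inequality with equal weights. For \<open>u = ln f\<close> with positive
  \<open>f\<close> it compares the geometric with the arithmetic mean.\<close>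

lemma exp_average_le:
  assumes "n > 0"
  shows "exp (average u n) \<le> average (\<lambda>k. exp (u k)) n"
proof -
  have "exp (\<Sum>k=1..n. (1 / real n) *\<^sub>R u k) \<le> (\<Sum>k=1..n. 1 / real n * exp (u k))"
    using assms by (intro convex_on_sum[OF _ _ exp_convex]) auto
  then show ?thesis by (simp add: average_def sum_divide_distrib)
qed

text \<open>The uniform lower bound \<open>c\<close> replaces the denominator in (1 - g)/g, so that
  a constant multiple of the given series dominates.\<close>

lemma summable_ln_of_summable_one_minus:
  fixes g :: "nat \<Rightarrow> real"
  assumes g: "\<And>n. n \<ge> 1 \<Longrightarrow> g n \<le> 1" and c: "c > 0" "\<And>n. n \<ge> 1 \<Longrightarrow> c < g n"
    and sum: "summable (\<lambda>d. (1 - g (Suc d)) / real (Suc d))"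
  shows "summable (\<lambda>d. \<bar>ln (g (Suc d))\<bar> / real (Suc d))"
proof (rule summable_comparison_test')
  show "summable (\<lambda>d. 1 / c * ((1 - g (Suc d)) / real (Suc d)))" by (rule summable_mult[OF sum])
  fix d :: nat
  have gd: "0 < g (Suc d)" "g (Suc d) \<le> 1" "c < g (Suc d)" using g[of "Suc d"] c(1) c(2)[of "Suc d"] by auto
  have "\<bar>ln (g (Suc d))\<bar> = - ln (g (Suc d))" using gd by simp
  also have "\<dots> = ln (1 / g (Suc d))" using gd by (simp add: ln_div)
  also have "\<dots> \<le> 1 / g (Suc d) - 1" using gd by (intro ln_le_minus_one) auto
  also have "\<dots> = (1 - g (Suc d)) / g (Suc d)" using gd by (simp add: field_simps)
  also have "\<dots> \<le> (1 - g (Suc d)) / c" using gd c(1) by (intro divide_left_mono mult_pos_pos) linarith+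
  finally have "\<bar>ln (g (Suc d))\<bar> / real (Suc d) \<le> (1 - g (Suc d)) / c / real (Suc d)"
    by (rule divide_right_mono) simp
  then show "norm (\<bar>ln (g (Suc d))\<bar> / real (Suc d)) \<le> 1 / c * ((1 - g (Suc d)) / real (Suc d))"
    by simp
qed

theorem theorem3p2:
  fixes N :: nat and g f :: "nat \<Rightarrow> real" and L :: "nat \<Rightarrow> nat" and A :: "nat \<Rightarrow> real"
  assumes "N \<ge> 1"
    and "density_like N g"
    and "summable (\<lambda>d. (1 - g (Suc d)) / real (Suc d))"
    and f_eq: "f = divisor_prod g"
    and "\<And>t. t \<ge> 1 \<Longrightarrow> L t \<ge> 1"
    and "\<And>t. t \<ge> 1 \<Longrightarrow> L t dvd L (t + 1)"
    and "filterlim L at_top sequentially"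
    and "\<exists>h :: real \<Rightarrow> real. filterlim h at_top at_top \<and>
           (\<forall>t::nat. t \<ge> 1 \<longrightarrow>
             (\<forall>n::nat. n \<ge> 1 \<and> gcd n N = 1 \<and> \<not> n dvd L t \<longrightarrow> h (real t) < real n))"
    and A_eq: "\<And>t. t \<ge> 1 \<Longrightarrow>
           A t = 1 / real (L t) * (\<Sum>r | r dvd L t. f r * real (totient (L t div r)))"
  shows "\<exists>A_f. A_f \<in> {0..1} \<and> A \<longlonglongrightarrow> A_f \<and> has_mean_value f A_f \<and>
           ((\<exists>c>0. \<forall>d\<ge>1. g d > c) \<longrightarrow>
             (\<exists>A_star. (\<lambda>d. ln (g (Suc d)) / real (Suc d)) sums A_star \<and>
                ((\<lambda>d. ln (g d) / real d) has_sum A_star) {d. d \<ge> 1 \<and> gcd d N = 1} \<and>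
                has_mean_value (\<lambda>n. ln (f n)) A_star \<and>
                A_f \<ge> exp A_star \<and>
                (\<lambda>d. g (Suc d) powr (1 / real (Suc d))) has_prod exp A_star \<and>
                exp A_star > 0 \<and>
                A_f \<noteq> 0))"
proof -
  have g_pos: "0 < g n" and g_le: "g n \<le> 1" if "n \<ge> 1" for n
    using assms(2) that by (auto simp: density_like_def)
  have g_one: "g n = 1" if "n \<ge> 1" "gcd n N > 1" for n
    using assms(2) that by (auto simp: density_like_def)
  have pos_of_dvd: "d \<ge> 1" if "d dvd n" "n \<ge> 1" for d n :: nat
    using that by (auto intro: Suc_leI dvd_pos_nat)
  have gcd_ge_1: "gcd n m \<ge> 1" if "n \<ge> 1" for n m :: nat
    using that by (simp add: Suc_le_eq)
  have prod01: "0 < (\<Prod>d\<in>S. g d) \<and> (\<Prod>d\<in>S. g d) \<le> 1" if "\<And>d. d \<in> S \<Longrightarrow> d \<ge> 1" for S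
  proof
    show "0 < (\<Prod>d\<in>S. g d)" using g_pos that by (intro prod_pos) auto
    show "(\<Prod>d\<in>S. g d) \<le> 1" using g_pos g_le that by (intro prod_le_1) (auto intro: less_imp_le)
  qed
  have f_pos: "0 < f n" and f_le: "f n \<le> 1" if "n \<ge> 1" for n
    using prod01[of "{d. d dvd n}"] pos_of_dvd that by (auto simp: f_eq divisor_prod_def)

  \<comment> \<open>Truncating \<open>f\<close> to the divisors of \<open>L t\<close>\<close>
  define F where "F t n = f (gcd n (L t))" for t n
  \<comment> \<open>\<open>w t d\<close> is the deficiency of a divisor that the truncation ignores,
    and \<open>\<epsilon> t\<close> will bound the resulting error of every average.\<close>
  define w where "w t d = (if d dvd L t then 0 else 1 - g d)" for t d
  define \<epsilon> where "\<epsilon> t = (\<Sum>d. w t (Suc d) / real (Suc d))" for t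

  \<comment> \<open>The divisors of \<open>n\<close> that also divide \<open>m\<close> are exactly
    those of \<open>gcd n m\<close>. Keeping \<open>m\<close> general allows a later comparison of
    two truncations.\<close>
  have f_split: "f n = f (gcd n m) * (\<Prod>d | d dvd n \<and> \<not> d dvd m. g d)" if "n \<ge> 1" for n m
  proof -
    have "{d. d dvd n} = {d. d dvd gcd n m} \<union> {d. d dvd n \<and> \<not> d dvd m}" by auto
    moreover have "prod g ({d. d dvd gcd n m} \<union> {d. d dvd n \<and> \<not> d dvd m}) =
        prod g {d. d dvd gcd n m} * prod g {d. d dvd n \<and> \<not> d dvd m}"
      using that by (intro prod.union_disjoint) auto
    ultimately show ?thesis by (simp only: f_eq divisor_prod_def)
  qed
  have f_gcd_le: "f n \<le> f (gcd n m)" if "n \<ge> 1" for n m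
  proof -
    have "(\<Prod>d | d dvd n \<and> \<not> d dvd m. g d) \<le> 1" by (rule prod01[THEN conjunct2]) (use that pos_of_dvd[of _ n] in simp)
    moreover have "0 < f (gcd n m)" using that by (intro f_pos gcd_ge_1)
    ultimately show ?thesis unfolding f_split[OF that, of m] by (simp add: mult_left_le)
  qed
  have f_gcd_diff_le: "f (gcd n m) - f n \<le> (\<Sum>d | d dvd n \<and> \<not> d dvd m. 1 - g d)" if "n \<ge> 1" for n m
  proof -
    let ?P = "\<Prod>d | d dvd n \<and> \<not> d dvd m. g d"
    have G: "0 < f (gcd n m)" "f (gcd n m) \<le> 1" using gcd_ge_1[OF that] by (rule f_pos, rule f_le)
    have "?P \<le> 1" by (rule prod01[THEN conjunct2]) (use that pos_of_dvd[of _ n] in simp)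
    then have "f (gcd n m) * (1 - ?P) \<le> 1 - ?P" using G by (intro mult_left_le_one_le) auto
    also have "\<dots> \<le> (\<Sum>d | d dvd n \<and> \<not> d dvd m. 1 - g d)"
    proof (rule one_minus_prod_le_sum)
      fix d assume "d \<in> {d. d dvd n \<and> \<not> d dvd m}"
      then have "d \<ge> 1" using that pos_of_dvd[of d n] by simp
      then show "0 \<le> g d \<and> g d \<le> 1" using g_pos[of d] g_le[of d] by simp
    qed (use that in simp)
    finally show ?thesis unfolding f_split[OF that, of m] by (simp add: algebra_simps)
  qed

  \<comment> \<open>The truncation error and its decay\<close>
  have w_nonneg: "0 \<le> w t (Suc d)" and w_le: "w t (Suc d) \<le> 1 - g (Suc d)" for t d
    using g_le[of "Suc d"] by (auto simp: w_def)
  have w_summable: "summable (\<lambda>d. w t (Suc d) / real (Suc d))" for t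
  proof (rule summable_comparison_test'[OF assms(3)])
    show "norm (w t (Suc d) / real (Suc d)) \<le> (1 - g (Suc d)) / real (Suc d)" for d
      using w_nonneg[of t d] w_le[of t d] by (simp add: divide_right_mono)
  qed
  \<comment> \<open>If \<open>Suc d\<close> is coprime to \<open>N\<close>, then \<open>h\<close>
    eventually reaches it, so failing to divide \<open>L t\<close> would contradict the hypothesis
    on \<open>h\<close>. Otherwise \<open>g (Suc d) = 1\<close> and the weight is \<open>0\<close>
    in any case.\<close>
  have w_zero: "eventually (\<lambda>t. w t (Suc d) = 0) sequentially" for d
  proof (cases "gcd (Suc d) N = 1")
    case True
    from assms(8) obtain h :: "real \<Rightarrow> real" where h: "filterlim h at_top at_top"
      "\<forall>t::nat. t \<ge> 1 \<longrightarrow>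
        (\<forall>n::nat. n \<ge> 1 \<and> gcd n N = 1 \<and> \<not> n dvd L t \<longrightarrow> h (real t) < real n)"
      by (elim exE conjE)
    have "filterlim (\<lambda>t. h (real t)) at_top sequentially"
      by (rule filterlim_compose[OF h(1) filterlim_real_sequentially])
    then have "eventually (\<lambda>t. real (Suc d) \<le> h (real t)) sequentially"
      by (simp add: filterlim_at_top)
    with eventually_ge_at_top[of 1] show ?thesis
    proof eventually_elim
      case (elim t)
      then have "Suc d dvd L t" using h(2)[rule_format, of t "Suc d"] True by linarith
      then show ?case by (simp add: w_def)
    qed
  next
    case False
    moreover have "gcd (Suc d) N > 0" by simp
    ultimately have "g (Suc d) = 1" by (intro g_one) linarith+
    then show ?thesis by (simp add: w_def)
  qed
  have eps_lim: "\<epsilon> \<longlonglongrightarrow> 0"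
  proof -
    have "(\<lambda>t. \<Sum>d. w t (Suc d) / real (Suc d)) \<longlonglongrightarrow> (\<Sum>d::nat. 0)"
    proof (rule tannery_sequentially[OF _ _ assms(3)])
      show "(\<lambda>t. w t (Suc d) / real (Suc d)) \<longlonglongrightarrow> 0" for d
        by (rule tendsto_eventually) (use w_zero[of d] in \<open>auto elim: eventually_mono\<close>)
      show "\<bar>w t (Suc d) / real (Suc d)\<bar> \<le> (1 - g (Suc d)) / real (Suc d)" for d t
        using w_nonneg[of t d] w_le[of t d] by (simp add: divide_right_mono)
    qed
    then show ?thesis unfolding \<epsilon>_def by (simp only: suminf_zero)
  qed

  have avg_diff: "\<bar>average (F t) n - average f n\<bar> \<le> \<epsilon> t" if "t \<ge> 1" for t n
  proof -
    have "average f n \<le> average (F t) n"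
      by (intro average_mono) (simp add: F_def f_gcd_le)
    moreover have "average (\<lambda>k. F t k - f k) n \<le> average (\<lambda>k. \<Sum>d | d dvd k. w t d) n"
    proof (rule average_mono)
      fix k :: nat assume "1 \<le> k"
      then have "F t k - f k \<le> (\<Sum>d | d dvd k \<and> \<not> d dvd L t. 1 - g d)"
        unfolding F_def by (rule f_gcd_diff_le)
      also have "\<dots> = (\<Sum>d | d dvd k. w t d)"
        using \<open>1 \<le> k\<close> by (intro sum.mono_neutral_cong_left) (auto simp: w_def)
      finally show "F t k - f k \<le> (\<Sum>d | d dvd k. w t d)" .
    qed
    moreover have "average (\<lambda>k. \<Sum>d | d dvd k. w t d) n \<le> \<epsilon> t"
      unfolding \<epsilon>_def by (intro average_divisor_sum_le w_nonneg w_summable)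
    ultimately show ?thesis by (simp add: average_diff)
  qed

  \<comment> \<open>Convergence of the means of the truncations\<close>
  have A_avg: "average (F t) \<longlonglongrightarrow> A t" if "t \<ge> 1" for t
  proof -
    have "average (F t) \<longlonglongrightarrow> average (F t) (L t)"
      by (rule average_periodic) (use assms(5)[OF that] in \<open>auto simp: F_def\<close>)
    also have "average (F t) (L t) = A t"
      unfolding average_def F_def A_eq[OF that]
      by (subst sum_gcd_eq_totient_sum) (use assms(5)[OF that] in auto)
    finally show ?thesis .
  qed
  have F01: "0 \<le> F t k" "F t k \<le> 1" if "k \<ge> 1" for t k
    using f_pos[of "gcd k (L t)"] f_le[of "gcd k (L t)"] gcd_ge_1[OF that]
    by (auto simp: F_def)
  have A01: "0 \<le> A t" "A t \<le> 1" if "t \<ge> 1" for t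
  proof -
    have "0 \<le> average (F t) n" for n
      unfolding average_def by (intro divide_nonneg_nonneg sum_nonneg F01) auto
    then show "0 \<le> A t" using A_avg[OF that] by (intro LIMSEQ_le_const) auto
    have "average (F t) n \<le> 1" for n
      using average_mono[of n "F t" "\<lambda>_. 1"] F01 by (auto simp: average_def split: if_splits)
    then show "A t \<le> 1" using A_avg[OF that] by (intro LIMSEQ_le_const2) auto
  qed
  \<comment> \<open>Passing to a multiple of \<open>L t\<close> adds factors at most
    \<open>1\<close>, so the means decrease. The shift by \<open>Suc\<close> reflects that
    \<open>L\<close> and \<open>A\<close> are controlled only from index \<open>1\<close>
    on.\<close>
  have "decseq (\<lambda>t. A (Suc t))"
  proof (rule decseq_SucI)
    fix t
    have "F (Suc (Suc t)) k \<le> F (Suc t) k" if "k \<ge> 1" for k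
    proof -
      have "gcd (gcd k (L (Suc (Suc t)))) (L (Suc t)) = gcd k (L (Suc t))"
        using assms(6)[of "Suc t"] by (simp add: gcd.assoc gcd_proj2_if_dvd)
      moreover have "gcd k (L (Suc (Suc t))) \<ge> 1" by (rule gcd_ge_1[OF that])
      ultimately show ?thesis unfolding F_def by (metis f_gcd_le)
    qed
    then have "average (F (Suc (Suc t))) n \<le> average (F (Suc t)) n" for n
      by (intro average_mono)
    then show "A (Suc (Suc t)) \<le> A (Suc t)"
      using A_avg[of "Suc t"] A_avg[of "Suc (Suc t)"] by (intro LIMSEQ_le) auto
  qed
  then obtain A_f where "(\<lambda>t. A (Suc t)) \<longlonglongrightarrow> A_f"
    by (rule decseq_convergent[where B = 0]) (use A01 in auto)
  then have A_lim: "A \<longlonglongrightarrow> A_f" by (rule LIMSEQ_imp_Suc)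
  have A_f01: "A_f \<in> {0..1}"
    using LIMSEQ_le_const[OF A_lim, of 0] LIMSEQ_le_const2[OF A_lim, of 1] A01 by auto

  have f_avg: "average f \<longlonglongrightarrow> A_f"
  proof (rule swap_uniform_limit')
    show "eventually (\<lambda>t. average (F t) \<longlonglongrightarrow> A t) sequentially"
      using eventually_ge_at_top[of 1] by eventually_elim (rule A_avg)
    \<comment> \<open>\<open>UNIV\<close> includes length \<open>0\<close>, where division by zero
      makes both averages \<open>0\<close>.\<close>
    show "uniform_limit UNIV (\<lambda>t. average (F t)) (average f) sequentially"
      unfolding uniform_limit_iff
    proof (intro allI impI)
      fix e :: real assume "e > 0"
      with eps_lim have "eventually (\<lambda>t. \<epsilon> t < e) sequentially" by (rule order_tendstoD)
      with eventually_ge_at_top[of 1]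
      show "eventually (\<lambda>t. \<forall>n\<in>UNIV. dist (average (F t) n) (average f n) < e) sequentially"
        by eventually_elim (use avg_diff in \<open>auto simp: dist_real_def intro: le_less_trans\<close>)
    qed
  qed (use A_lim in auto)

  \<comment> \<open>The logarithmic mean and the lower bound\<close>
  show ?thesis
  proof (rule exI[of _ A_f], intro conjI impI A_f01 A_lim has_mean_valueI[OF f_avg])
    assume "\<exists>c>0. \<forall>d\<ge>1. g d > c"
    then obtain c where c: "c > 0" "\<And>d. d \<ge> 1 \<Longrightarrow> c < g d" by auto
    have abs_sum: "summable (\<lambda>d. \<bar>ln (g (Suc d))\<bar> / real (Suc d))"
      by (rule summable_ln_of_summable_one_minus[OF g_le c assms(3)])
    then have norm_sum: "summable (\<lambda>d. norm (ln (g (Suc d)) / real (Suc d)))" by simp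
    define A_star where "A_star = (\<Sum>d. ln (g (Suc d)) / real (Suc d))"
    have sums: "(\<lambda>d. ln (g (Suc d)) / real (Suc d)) sums A_star"
      unfolding A_star_def by (intro summable_sums summable_norm_cancel[OF norm_sum])
    \<comment> \<open>Absolute convergence turns the ordered series into an unordered sum, which can
      be reindexed by \<open>Suc\<close> and then restricted: terms with \<open>gcd d N > 1\<close>
      vanish because \<open>ln 1 = 0\<close>.\<close>
    have "((\<lambda>d. ln (g (Suc d)) / real (Suc d)) has_sum A_star) UNIV"
      by (rule norm_summable_imp_has_sum[OF norm_sum sums])
    then have "((\<lambda>d. ln (g d) / real d) has_sum A_star) (range Suc)"
      by (subst has_sum_reindex) (auto simp: o_def)
    moreover have "ln (g d) / real d = 0" if "d \<in> range Suc - {d. d \<ge> 1 \<and> gcd d N = 1}" for d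
    proof -
      have "d \<ge> 1" "gcd d N > 1" using that by (auto simp: Suc_lessI)
      then show ?thesis by (simp add: g_one)
    qed
    moreover have "{d. d \<ge> 1 \<and> gcd d N = 1} \<subseteq> range Suc" by (auto simp: image_iff Suc_le_D)
    ultimately have has_sum: "((\<lambda>d. ln (g d) / real d) has_sum A_star) {d. d \<ge> 1 \<and> gcd d N = 1}"
      by (subst has_sum_cong_neutral[of "range Suc"]) auto
    have ln_f: "ln (f k) = (\<Sum>d | d dvd k. ln (g d))" if "k \<ge> 1" for k
      unfolding f_eq divisor_prod_def
      by (rule ln_prod) (use that g_pos pos_of_dvd in \<open>auto simp: less_imp_neq[symmetric]\<close>)
    \<comment> \<open>The logarithm of \<open>f\<close> is itself a divisor sum, with weights
      \<open>ln (g d)\<close>, so its mean comes directly from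
      \<open>average_divisor_sum_tendsto\<close> without truncation.\<close>
    have "average (\<lambda>n. ln (f n)) = average (\<lambda>k. \<Sum>d | d dvd k. ln (g d))"
      by (intro ext, unfold average_def) (simp add: ln_f)
    then have ln_avg: "average (\<lambda>n. ln (f n)) \<longlonglongrightarrow> A_star"
      unfolding A_star_def using average_divisor_sum_tendsto[OF abs_sum] by simp
    have A_f_ge: "A_f \<ge> exp A_star"
    \<comment> \<open>The comparison starts at \<open>n = 1\<close>: at \<open>n = 0\<close> both
      averages are \<open>0\<close> and it would read \<open>exp 0 \<le> 0\<close>.\<close>
    proof (rule LIMSEQ_le[OF tendsto_exp[OF ln_avg] f_avg], intro exI[of _ 1] allI impI)
      fix n :: nat assume "n \<ge> 1"
      then have "exp (average (\<lambda>k. ln (f k)) n) \<le> average (\<lambda>k. exp (ln (f k))) n"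
        by (intro exp_average_le) auto
      also have "\<dots> = average f n" by (simp add: average_def f_pos)
      finally show "exp (average (\<lambda>k. ln (f k)) n) \<le> average f n" .
    qed
    \<comment> \<open>The first disjunct of \<open>has_prod_def\<close> is convergence to a nonzero
      limit, which here is an exponential.\<close>
    have "(\<lambda>d. exp (ln (g (Suc d)) / real (Suc d))) has_prod exp A_star"
      unfolding has_prod_def by (intro disjI1 sums_imp_has_prod_exp sums)
    moreover have "exp (ln (g (Suc d)) / real (Suc d)) = g (Suc d) powr (1 / real (Suc d))" for d
      using g_pos[of "Suc d"] by (simp add: powr_def)
    ultimately have prod: "(\<lambda>d. g (Suc d) powr (1 / real (Suc d))) has_prod exp A_star" by simp
    have "A_f \<noteq> 0" using A_f_ge exp_gt_zero[of A_star] by linarith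
    then show "\<exists>A_star. (\<lambda>d. ln (g (Suc d)) / real (Suc d)) sums A_star \<and>
        ((\<lambda>d. ln (g d) / real d) has_sum A_star) {d. d \<ge> 1 \<and> gcd d N = 1} \<and>
        has_mean_value (\<lambda>n. ln (f n)) A_star \<and> A_f \<ge> exp A_star \<and>
        (\<lambda>d. g (Suc d) powr (1 / real (Suc d))) has_prod exp A_star \<and>
        exp A_star > 0 \<and> A_f \<noteq> 0"
      using sums has_sum has_mean_valueI[OF ln_avg] A_f_ge prod by (intro exI[of _ A_star]) simp
  qed
qed

end
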